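(* Let $\mathcal G$ be a terminating graph in which each terminal node has been assigned a positive value, and suppose the players use the limiting strategies in the Path Guessing Game on $\mathcal G$, so that the position process $(X_t)_{t\ge0}$ is the Markov chain with transition probabilities $p_{i,j}$. Let $T=\min\{t\ge0:X_t\text{ is terminal}\}$. Then the vector $\tau=(E[T\mid X_0=i])_{i\text{ non-terminal}}$ of expected stopping times is $$\tau=V_{\mathrm{nt}}(I-A)^{-1}V_{\mathrm{nt}}^{-1}\mathbf 1;$$ for every $t\ge1$ the vector $q_t=(\mathrm{Prob}(T=t\mid X_0=i))_{i\text{ non-terminal}}$ is $$q_t=V_{\mathrm{nt}}A^{t-1}BV_{\mathrm t}^{-1}\mathbf 1;$$ and the matrix of terminal probabilities $\rho=(\mathrm{Prob}(X_T=k\mid X_0=i))_{i\text{ non-terminal},\,k\text{ terminal}}$ is $$\rho=V_{\mathrm{nt}}(I-A)^{-1}BV_{\mathrm t}^{-1}.$$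
   Context: $\mathcal G=(\mathcal V,\mathcal E)$ is a finite directed graph (at most one edge from $i$ to $j$; loops allowed); $i\to j$ means there is an edge from $i$ to $j$, and $n_i$ is the out-degree of $i$. A node is terminal if its out-degree is $0$; each terminal node $j$ carries a pre-assigned positive value $v_j$. A terminating graph is a connected digraph in which every non-terminal node has a directed path to some terminal node. Propagation matrix: $M=(m_{i,j})$ with $m_{i,i}=1$ for $i$ terminal; $m_{i,j}=1/2$ if $n_i=1$ and $i\to j$; $m_{i,j}=1/n_i$ if $n_i\ge2$ and $i\to j$; and $m_{i,j}=0$ otherwise. Numbering the non-terminal nodes first, write $M=\begin{bmatrix}A&B\\0&I\end{bmatrix}$, with $A$ indexed by non-terminal nodes and $B$ by (non-terminal, terminal) pairs. The matrix $I-A$ is invertible. Limiting values: let $u_0$ be the vector with entry $1$ at each non-terminal node and $v_j^{-1}$ at each terminal node $j$; the limiting reciprocal value vector is $u=\lim_{s\to\infty}M^su_0$ (it exists and is strictly positive), and the limiting values are $v_i=u_i^{-1}$. $V_{\mathrm{nt}}$ and $V_{\mathrm t}$ are the diagonal matrices of limiting values of the non-terminal and terminal nodes respectively; $\mathbf 1$ is the all-ones vector of the appropriate length. In the Path Guessing Game the players' common position $X_t$ moves along edges selected by the Chooser. Under the Chooser's limiting strategy, from a non-terminal node $i$ he moves to $j$ with probability $p_{i,j}=1$ if $n_i=1$ and $i\to j$; $p_{i,j}=u_j/\sum_{k:\,i\to k}u_k$ if $n_i\ge2$ and $i\to j$; and $p_{i,j}=0$ otherwise. Terminal nodes are absorbing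 ($p_{i,i}=1$). (The Guesser's strategy does not affect the positions.) *)

theory Defs
  imports
    "HOL-Probability.Probability"
    "Graph_Theory.Pair_Digraph"
    "Graph_Theory.Digraph_Component"
    "Jordan_Normal_Form.Matrix"
    "Jordan_Normal_Form.Gauss_Jordan_Elimination"
begin

hide_const (open) Finite_Cartesian_Product.mat Finite_Cartesian_Product.vec

section \<open>Terminating graphs\<close>

definition terminal :: "'a pair_pre_digraph \<Rightarrow> 'a \<Rightarrow> bool" where
  "terminal G i \<longleftrightarrow> i \<in> pverts G \<and> out_degree G i = 0"

definition non_terminal :: "'a pair_pre_digraph \<Rightarrow> 'a \<Rightarrow> bool" where
  "non_terminal G i \<longleftrightarrow> i \<in> pverts G \<and> out_degree G i \<noteq> 0"

text \<open>The library's \<^const>\<open>connected\<close> refers to the underlying undirected graph,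
  and \<^locale>\<open>pair_fin_digraph\<close> allows loops.\<close>

locale terminating_graph = pair_fin_digraph G for G :: "'a pair_pre_digraph" +
  assumes connected: "Digraph_Component.connected G"
  and reaches_terminal: "non_terminal G i \<Longrightarrow> \<exists>j. terminal G j \<and> i \<rightarrow>\<^sup>*\<^bsub>G\<^esub> j"

text \<open>Matrices over the nodes are indexed through a numbering of the nodes: \<open>ns\<close> lists
  the non-terminal nodes and \<open>ts\<close> the terminal ones, so that \<open>ns @ ts\<close> numbers all nodes
  with the non-terminal ones first.\<close>

definition node_numbering :: "'a pair_pre_digraph \<Rightarrow> 'a list \<Rightarrow> 'a list \<Rightarrow> bool" where
  "node_numbering G ns ts \<longleftrightarrow>
     distinct ns \<and> set ns = {i. non_terminal G i} \<and> distinct ts \<and> set ts = {i. terminal G i}"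

definition node_index :: "'a list \<Rightarrow> 'a \<Rightarrow> nat" where
  "node_index xs i = the_inv_into {..<length xs} ((!) xs) i"

definition node_mat :: "('a \<Rightarrow> 'a \<Rightarrow> real) \<Rightarrow> 'a list \<Rightarrow> 'a list \<Rightarrow> real mat" where
  "node_mat f xs ys = mat (length xs) (length ys) (\<lambda>(r, c). f (xs ! r) (ys ! c))"

section \<open>The propagation matrix and limiting values\<close>

definition prop_entry :: "'a pair_pre_digraph \<Rightarrow> 'a \<Rightarrow> 'a \<Rightarrow> real" where
  "prop_entry G i j =
     (if terminal G i \<and> j = i then 1
      else if out_degree G i = 1 \<and> i \<rightarrow>\<^bsub>G\<^esub> j then 1 / 2
      else if out_degree G i \<ge> 2 \<and> i \<rightarrow>\<^bsub>G\<^esub> j then 1 / real (out_degree G i)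
      else 0)"

definition prop_mat :: "'a pair_pre_digraph \<Rightarrow> 'a list \<Rightarrow> 'a list \<Rightarrow> real mat" where
  "prop_mat G ns ts = node_mat (prop_entry G) (ns @ ts) (ns @ ts)"

definition block_A :: "'a pair_pre_digraph \<Rightarrow> 'a list \<Rightarrow> real mat" where
  "block_A G ns = node_mat (prop_entry G) ns ns"

definition block_B :: "'a pair_pre_digraph \<Rightarrow> 'a list \<Rightarrow> 'a list \<Rightarrow> real mat" where
  "block_B G ns ts = node_mat (prop_entry G) ns ts"

lemma prop_mat_four_block:
  assumes "node_numbering G ns ts"
  shows "prop_mat G ns ts =
    four_block_mat (block_A G ns) (block_B G ns ts)
      (0\<^sub>m (length ts) (length ns)) (1\<^sub>m (length ts))"
proof -
  have T: "terminal G (ts ! r)" if "r < length ts" for r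
    using assms nth_mem[OF that] by (auto simp: node_numbering_def)
  have N: "non_terminal G (ns ! r)" if "r < length ns" for r
    using assms nth_mem[OF that] by (auto simp: node_numbering_def)
  have *: "prop_entry G (ts ! r) j = (if j = ts ! r then 1 else 0)" if "r < length ts" for r j
    using T[OF that] by (auto simp: prop_entry_def terminal_def)
  have ne: "ns ! c \<noteq> ts ! r" if "r < length ts" "c < length ns" for r c
    using T[OF that(1)] N[OF that(2)] by (auto simp: terminal_def non_terminal_def)
  have d: "distinct ts" using assms by (simp add: node_numbering_def)
  show ?thesis
    by (rule eq_matI)
      (auto simp: prop_mat_def block_A_def block_B_def node_mat_def nth_append * ne
         nth_eq_iff_index_eq[OF d])
qed

definition init_vec :: "'a pair_pre_digraph \<Rightarrow> ('a \<Rightarrow> real) \<Rightarrow> 'a list \<Rightarrow> 'a list \<Rightarrow> real vec" where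
  "init_vec G v ns ts =
     vec (length (ns @ ts))
       (\<lambda>r. if terminal G ((ns @ ts) ! r) then inverse (v ((ns @ ts) ! r)) else 1)"

text \<open>\<open>limit_recip G v ns ts i\<close> is the entry at node \<open>i\<close> of the limiting reciprocal
  value vector; vectors of \<^typ>\<open>real vec\<close> carry no topology, so the limit is taken entrywise.\<close>

definition limit_recip ::
  "'a pair_pre_digraph \<Rightarrow> ('a \<Rightarrow> real) \<Rightarrow> 'a list \<Rightarrow> 'a list \<Rightarrow> 'a \<Rightarrow> real" where
  "limit_recip G v ns ts i =
     lim (\<lambda>s. ((prop_mat G ns ts ^\<^sub>m s) *\<^sub>v init_vec G v ns ts) $ node_index (ns @ ts) i)"

definition limit_value ::
  "'a pair_pre_digraph \<Rightarrow> ('a \<Rightarrow> real) \<Rightarrow> 'a list \<Rightarrow> 'a list \<Rightarrow> 'a \<Rightarrow> real" where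
  "limit_value G v ns ts i = inverse (limit_recip G v ns ts i)"

definition V_nt ::
  "'a pair_pre_digraph \<Rightarrow> ('a \<Rightarrow> real) \<Rightarrow> 'a list \<Rightarrow> 'a list \<Rightarrow> real mat" where
  "V_nt G v ns ts = mat_diag (length ns) (\<lambda>r. limit_value G v ns ts (ns ! r))"

definition V_t ::
  "'a pair_pre_digraph \<Rightarrow> ('a \<Rightarrow> real) \<Rightarrow> 'a list \<Rightarrow> 'a list \<Rightarrow> real mat" where
  "V_t G v ns ts = mat_diag (length ts) (\<lambda>c. limit_value G v ns ts (ts ! c))"

abbreviation ones :: "nat \<Rightarrow> real vec" where
  "ones n \<equiv> vec n (\<lambda>_. 1)"

text \<open>Unspecified for singular matrices.\<close>

abbreviation mat_inv :: "real mat \<Rightarrow> real mat" where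
  "mat_inv A \<equiv> the (mat_inverse A)"

section \<open>The position process under the Chooser's limiting strategy\<close>

definition chooser_prob ::
  "'a pair_pre_digraph \<Rightarrow> ('a \<Rightarrow> real) \<Rightarrow> 'a list \<Rightarrow> 'a list \<Rightarrow> 'a \<Rightarrow> 'a \<Rightarrow> real" where
  "chooser_prob G v ns ts i j =
     (if terminal G i \<and> j = i then 1
      else if out_degree G i = 1 \<and> i \<rightarrow>\<^bsub>G\<^esub> j then 1
      else if out_degree G i \<ge> 2 \<and> i \<rightarrow>\<^bsub>G\<^esub> j
        then limit_recip G v ns ts j / (\<Sum>k | i \<rightarrow>\<^bsub>G\<^esub> k. limit_recip G v ns ts k)
      else 0)"

text \<open>A time-homogeneous Markov chain with countable (here finite) state space \<open>S\<close>,
  transition probabilities \<open>p\<close> and arbitrary initial distribution.\<close>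

locale markov_chain = prob_space P
  for P :: "'w measure" and S :: "'a set" and p :: "'a \<Rightarrow> 'a \<Rightarrow> real" and X :: "nat \<Rightarrow> 'w \<Rightarrow> 'a" +
  assumes measurable_X: "X t \<in> measurable P (count_space S)"
  and markov:
    "\<lbrakk>\<P>(\<omega> in P. \<forall>s\<le>t. X s \<omega> = x s) > 0; j \<in> S\<rbrakk> \<Longrightarrow>
       \<P>(\<omega> in P. X (Suc t) \<omega> = j \<bar> \<forall>s\<le>t. X s \<omega> = x s) = p (x t) j"

text \<open>The first time at which the position is terminal; it is \<open>\<infinity>\<close> if there is none.\<close>

definition stop_time :: "'a pair_pre_digraph \<Rightarrow> (nat \<Rightarrow> 'w \<Rightarrow> 'a) \<Rightarrow> 'w \<Rightarrow> enat" where
  "stop_time G X \<omega> = (INF t\<in>{t. terminal G (X t \<omega>)}. enat t)"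

text \<open>Expectation of an extended non-negative quantity conditional on an event of positive
  probability.\<close>

definition cond_expect :: "'w measure \<Rightarrow> ('w \<Rightarrow> ennreal) \<Rightarrow> ('w \<Rightarrow> bool) \<Rightarrow> ennreal" where
  "cond_expect P f Q = (\<integral>\<^sup>+\<omega>. f \<omega> \<partial>uniform_measure P {\<omega> \<in> space P. Q \<omega>})"

end

theory Submission
  imports Defs "Jordan_Normal_Form.Determinant"
begin

text \<open>The limiting reciprocal vector \<open>u\<close> is a positive harmonic vector of the propagation matrix
  \<open>M\<close>, and the Chooser's transition probabilities are its Doob transform
  \<open>p i j = M i j * u j / u i\<close>. Hence products of \<open>p\<close> along paths telescope: the chain stopped at
  the terminal nodes has \<open>t\<close>-step matrix \<open>V A\<^sup>t V\<^sup>-\<^sup>1\<close>, which gives the law of \<open>T\<close>. The expectation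
  is the sum of the tails \<open>P (T > t)\<close>, and since the powers of \<open>A\<close> decay geometrically the
  occurring series are Neumann series of \<open>(I - A)\<^sup>-\<^sup>1\<close>.\<close>

section \<open>Node numberings, matrix inverses and Neumann series\<close>

lemma node_index_nth:
  assumes "distinct xs" "k < length xs"
  shows "node_index xs (xs ! k) = k"
  unfolding node_index_def
  by (rule the_inv_into_f_f) (use assms in \<open>auto simp: inj_on_def nth_eq_iff_index_eq\<close>)

lemma sum_nth_distinct:
  assumes "distinct xs"
  shows "(\<Sum>k<length xs. f (xs ! k)) = sum f (set xs)"
  using sum.reindex_bij_betw[OF bij_betw_nth[OF assms refl refl], of f]
  by (simp add: lessThan_atLeast0)

text \<open>Matrix powers are defined by multiplying on the right; the recursions below take one
  step from the starting node, which peels a factor off the left.\<close>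

lemma pow_mat_Suc_left:
  assumes "A \<in> carrier_mat n n"
  shows "A ^\<^sub>m Suc k = A * A ^\<^sub>m k"
proof (induction k)
  case (Suc k)
  have "A ^\<^sub>m Suc (Suc k) = A * A ^\<^sub>m k * A"
    using Suc by simp
  also have "\<dots> = A * (A ^\<^sub>m k * A)"
    using assms by (intro assoc_mult_mat[of _ n n _ n _ n]) auto
  finally show ?case by simp
qed (use assms in auto)

text \<open>A one-sided inverse of a real square matrix is two-sided, so \<open>A\<close> is a unit,
  \<open>mat_inverse\<close> returns some \<open>C\<close>, and \<open>C\<close> equals
  \<open>B\<close> by uniqueness of inverses. This gives \<open>mat_inv\<close> a specified
  value.\<close>

lemma mat_inv_eqI:
  assumes A: "A \<in> carrier_mat n n" and B: "B \<in> carrier_mat n n" and AB: "A * B = 1\<^sub>m n"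
  shows "mat_inv A = B"
proof -
  have BA: "B * A = 1\<^sub>m n"
    using mat_mult_left_right_inverse[OF A B AB] .
  have "A \<in> Units (ring_mat TYPE(real) n ())"
    using A B AB BA by (auto simp: Units_def ring_mat_simps)
  then obtain C where C: "mat_inverse A = Some C"
    using mat_inverse(1)[OF A, of "()"] by (cases "mat_inverse A") auto
  have "A * C = 1\<^sub>m n" "C \<in> carrier_mat n n"
    using mat_inverse(2)[OF A C] by auto
  hence "B * (A * C) = B" "B * (A * C) = C"
    using B BA assoc_mult_mat[OF B A, of C n] by auto
  thus ?thesis using C by simp
qed

lemma mat_inv_mat_diag:
  assumes "\<And>i. i < n \<Longrightarrow> f i \<noteq> 0"
  shows "mat_inv (mat_diag n f) = mat_diag n (\<lambda>i. inverse (f i))"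
  by (rule mat_inv_eqI[of _ n]) (use assms in \<open>auto simp: mat_diag_def scalar_prod_def
      if_distrib[of "\<lambda>x. x * _"] intro!: eq_matI cong: if_cong\<close>)

text \<open>Multiplying the series by \<open>A\<close> shifts it by one index, so the difference
  leaves only the identity. Convergence is entrywise, which suffices because each entry of a product
  is a finite sum.\<close>

lemma mat_inv_neumann:
  assumes A: "A \<in> carrier_mat n n"
    and summable: "\<And>i j. i < n \<Longrightarrow> j < n \<Longrightarrow> summable (\<lambda>t. (A ^\<^sub>m t) $$ (i, j))"
  shows "mat_inv (1\<^sub>m n - A) = mat n n (\<lambda>(i, j). \<Sum>t. (A ^\<^sub>m t) $$ (i, j))" (is "_ = ?N")
proof (rule mat_inv_eqI)
  show "(1\<^sub>m n - A) * ?N = 1\<^sub>m n"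
  proof (rule eq_matI)
    fix i j assume "i < dim_row (1\<^sub>m n)" "j < dim_col (1\<^sub>m n)"
    hence i: "i < n" and j: "j < n" by auto
    have pow: "A ^\<^sub>m t \<in> carrier_mat n n" for t
      using A by (rule pow_carrier_mat)
    have "(A * ?N) $$ (i, j) = (\<Sum>k<n. A $$ (i, k) * (\<Sum>t. (A ^\<^sub>m t) $$ (k, j)))"
      using A i j by (simp add: scalar_prod_def lessThan_atLeast0)
    also have "\<dots> = (\<Sum>k<n. \<Sum>t. A $$ (i, k) * (A ^\<^sub>m t) $$ (k, j))"
      using summable j by (intro sum.cong suminf_mult[symmetric]) auto
    also have "\<dots> = (\<Sum>t. \<Sum>k<n. A $$ (i, k) * (A ^\<^sub>m t) $$ (k, j))"
      using summable j by (intro suminf_sum[symmetric] summable_mult) auto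
    also have "\<dots> = (\<Sum>t. (A ^\<^sub>m Suc t) $$ (i, j))"
      using A i j pow unfolding pow_mat_Suc_left[OF A]
      by (simp add: scalar_prod_def lessThan_atLeast0)
    also have "\<dots> = (\<Sum>t. (A ^\<^sub>m t) $$ (i, j)) - 1\<^sub>m n $$ (i, j)"
      using suminf_split_head[OF summable[OF i j]] A by simp
    finally show "((1\<^sub>m n - A) * ?N) $$ (i, j) = 1\<^sub>m n $$ (i, j)"
      using A i j by (subst minus_mult_distrib_mat[of _ n n _ _ n]) auto
  qed (use A in auto)
qed (use A in auto)

lemma mult_mat_index:
  fixes M N :: "real mat"
  assumes "M \<in> carrier_mat n m" "N \<in> carrier_mat m k" "i < n" "j < k"
  shows "(M * N) $$ (i, j) = (\<Sum>l<m. M $$ (i, l) * N $$ (l, j))"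
  using assms by (simp add: scalar_prod_def lessThan_atLeast0)

lemma mat_diag_mult_sandwich:
  assumes M: "M \<in> carrier_mat n m" and "i < n" "j < m"
  shows "(mat_diag n f * M * mat_diag m g) $$ (i, j) = f i * M $$ (i, j) * g j"
  using assms by (simp add: mat_diag_mult_left[OF M] mat_diag_mult_right[of _ n])

lemma mult_ones_index:
  assumes "M \<in> carrier_mat n m" "i < n"
  shows "(M *\<^sub>v ones m) $ i = (\<Sum>j<m. M $$ (i, j))"
  using assms by (simp add: scalar_prod_def lessThan_atLeast0)

section \<open>Decay of the propagation iterates\<close>

context terminating_graph
begin

lemma terminal_in_verts: "terminal G i \<Longrightarrow> i \<in> pverts G"
  by (simp add: terminal_def)

lemma non_terminal_in_verts: "non_terminal G i \<Longrightarrow> i \<in> pverts G"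
  by (simp add: non_terminal_def)

lemma not_terminal_iff: "i \<in> pverts G \<Longrightarrow> \<not> terminal G i \<longleftrightarrow> non_terminal G i"
  by (simp add: terminal_def non_terminal_def)

lemma successors_subset: "{j. i \<rightarrow>\<^bsub>G\<^esub> j} \<subseteq> pverts G"
  using in_arcsD2 by auto

lemma finite_successors: "finite {j. i \<rightarrow>\<^bsub>G\<^esub> j}"
  using finite_subset[OF successors_subset pair_finite_verts] .

text \<open>Arcs are pairs of nodes, so the arcs leaving \<open>i\<close> correspond one to one to
  its successors.\<close>

lemma card_successors: "card {j. (i, j) \<in> parcs G} = out_degree G i"
proof -
  have "out_arcs G i = Pair i ` {j. (i, j) \<in> parcs G}"
    by (auto simp: out_arcs_def)
  thus ?thesis
    by (simp add: out_degree_def card_image inj_on_def)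
qed

lemma out_degree_le_card: "out_degree G i \<le> card (pverts G)"
  using card_mono[OF pair_finite_verts successors_subset] by (simp add: card_successors)

lemma arc_non_terminal: "i \<rightarrow>\<^bsub>G\<^esub> j \<Longrightarrow> non_terminal G i"
  using finite_successors[of i] in_arcsD1[of i j]
  by (auto simp: non_terminal_def simp flip: card_successors)

lemma prop_entry_terminal: "terminal G i \<Longrightarrow> prop_entry G i j = (if j = i then 1 else 0)"
  by (simp add: prop_entry_def terminal_def)

text \<open>The exceptional weight \<open>1 / 2\<close> at out-degree 1 fits the general formula
  once the out-degree is replaced by its maximum with 2; this removes a case distinction from most
  later arguments.\<close>

lemma prop_entry_non_terminal:
  "non_terminal G i \<Longrightarrow>
    prop_entry G i j = (if i \<rightarrow>\<^bsub>G\<^esub> j then 1 / real (max 2 (out_degree G i)) else 0)"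
  by (auto simp: prop_entry_def non_terminal_def terminal_def max_def)

lemma prop_entry_nonneg: "0 \<le> prop_entry G i j"
  by (simp add: prop_entry_def)

lemma sum_prop_entry_non_terminal:
  assumes "non_terminal G i"
  shows "(\<Sum>j\<in>pverts G. prop_entry G i j * f j)
    = (\<Sum>j | i \<rightarrow>\<^bsub>G\<^esub> j. f j) / real (max 2 (out_degree G i))"
proof -
  have "(\<Sum>j\<in>pverts G. prop_entry G i j * f j) = (\<Sum>j | i \<rightarrow>\<^bsub>G\<^esub> j. prop_entry G i j * f j)"
    using successors_subset pair_finite_verts assms
    by (intro sum.mono_neutral_right) (auto simp: prop_entry_non_terminal)
  thus ?thesis
    using assms by (simp add: prop_entry_non_terminal sum_divide_distrib)
qed

lemma sum_prop_entry_terminal: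
  "terminal G i \<Longrightarrow> (\<Sum>j\<in>pverts G. prop_entry G i j * f j) = f i"
  using pair_finite_verts
  by (simp add: prop_entry_terminal terminal_in_verts if_distrib[of "\<lambda>x. x * _"] cong: if_cong)

lemma sum_prop_entry_le_1: "non_terminal G i \<Longrightarrow> (\<Sum>j\<in>pverts G. prop_entry G i j) \<le> 1"
  using sum_prop_entry_non_terminal[of i "\<lambda>_. 1"] by (simp add: card_successors)

text \<open>Every node of the graph reaches a terminal node, so the minimum exists there; elsewhere
  \<open>LEAST\<close> is unspecified.\<close>

definition terminal_dist :: "'a \<Rightarrow> nat" where
  "terminal_dist i = (LEAST n. \<exists>j. terminal G j \<and> (i, j) \<in> parcs G ^^ n)"

text \<open>Take the first edge of a shortest path to a terminal node.\<close>

lemma terminal_dist_decreases: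
  assumes "non_terminal G i"
  obtains j where "i \<rightarrow>\<^bsub>G\<^esub> j" "terminal_dist j < terminal_dist i"
proof -
  let ?P = "\<lambda>i n. \<exists>j. terminal G j \<and> (i, j) \<in> parcs G ^^ n"
  obtain k where k: "terminal G k" "i \<rightarrow>\<^sup>*\<^bsub>G\<^esub> k"
    using reaches_terminal[OF assms] by blast
  hence "(i, k) \<in> (parcs G)\<^sup>*"
    using reachable_rtranclI[of "with_proj G" i k] by simp
  then obtain n where "?P i n"
    using k(1) by (auto simp: rtrancl_power)
  hence *: "?P i (terminal_dist i)"
    unfolding terminal_dist_def by (rule LeastI)
  then obtain m where m: "terminal_dist i = Suc m"
    using assms by (cases "terminal_dist i") (auto simp: terminal_def non_terminal_def)
  from * obtain j where j: "i \<rightarrow>\<^bsub>G\<^esub> j" "?P j m"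
    unfolding m by (auto elim!: relpow_Suc_E2 simp del: relpow.simps)
  have "terminal_dist j \<le> m"
    unfolding terminal_dist_def by (rule Least_le) (rule j(2))
  thus ?thesis using that j(1) m by simp
qed

text \<open>The weight \<open>w\<close> is \<open>1 - \<epsilon> ^ d\<close> with \<open>d\<close> the distance to the terminal nodes: some edge of
  entry at least \<open>2 * \<epsilon>\<close> lowers \<open>d\<close>, so averaging over the row at least doubles \<open>\<epsilon> ^ d\<close>, up to
  the missing row mass.\<close>

lemma contraction_weight:
  obtains \<theta> w where "0 \<le> \<theta>" "\<theta> < 1" "\<And>i. 0 \<le> w i" "\<And>i. non_terminal G i \<Longrightarrow> 1 / 2 \<le> w i"
    "\<And>i. non_terminal G i \<Longrightarrow> (\<Sum>j\<in>pverts G. prop_entry G i j * w j) \<le> \<theta> * w i"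
proof -
  \<comment> \<open>The maximum of 2 and an out-degree is at most
    \<open>card (pverts G) + 2\<close>, so \<open>\<delta>\<close> is a lower bound for all entries
    along edges.\<close>
  define \<delta> where "\<delta> = 1 / (real (card (pverts G)) + 2)"
  define \<epsilon> where "\<epsilon> = \<delta> / 2"
  define w where "w i = 1 - \<epsilon> ^ terminal_dist i" for i
  \<comment> \<open>The largest distance makes the contraction factor
    \<open>1 - \<epsilon> ^ R\<close> an upper bound for \<open>w\<close> on all nodes of the
    graph.\<close>
  define R where "R = Max (terminal_dist ` pverts G)"
  have \<epsilon>: "0 < \<epsilon>" "\<epsilon> \<le> 1 / 2" "\<delta> = 2 * \<epsilon>"
    by (auto simp: \<epsilon>_def \<delta>_def divide_simps)
  have w: "0 \<le> w i" "w i \<le> 1" for i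
    using \<epsilon> by (auto simp: w_def intro!: power_le_one)
  have \<delta>_le: "\<delta> \<le> prop_entry G i j" if "i \<rightarrow>\<^bsub>G\<^esub> j" for i j
    using that arc_non_terminal[OF that] out_degree_le_card[of i]
    by (auto simp: prop_entry_non_terminal \<delta>_def intro!: divide_left_mono)
  show ?thesis
  proof
    show "0 \<le> 1 - \<epsilon> ^ R" "1 - \<epsilon> ^ R < 1"
      using \<epsilon> by (auto intro!: power_le_one)
  next
    fix i show "0 \<le> w i" by (rule w)
  next
    fix i assume i: "non_terminal G i"
    obtain k where k: "i \<rightarrow>\<^bsub>G\<^esub> k" "terminal_dist k < terminal_dist i"
      using terminal_dist_decreases[OF i] .
    have k': "k \<in> pverts G" using k(1) in_arcsD2 by simp
    have "\<epsilon> ^ terminal_dist i \<le> \<epsilon> ^ 1"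
      using k(2) \<epsilon> by (intro power_decreasing) auto
    thus "1 / 2 \<le> w i" using \<epsilon> by (simp add: w_def)
    have "\<epsilon> ^ (terminal_dist i - 1) \<le> \<epsilon> ^ terminal_dist k"
      using k(2) \<epsilon> by (intro power_decreasing) auto
    hence "\<epsilon> * \<epsilon> ^ (terminal_dist i - 1) \<le> \<epsilon> * \<epsilon> ^ terminal_dist k"
      using \<epsilon> by simp
    hence *: "\<epsilon> ^ terminal_dist i \<le> \<epsilon> * \<epsilon> ^ terminal_dist k"
      using k(2) by (simp flip: power_Suc)
    \<comment> \<open>Of the row average of \<open>1 - w\<close>, only the term of the edge to
      \<open>k\<close> is kept; it alone is at least
      \<open>2 * \<epsilon> ^ terminal_dist i\<close>.\<close>
    have "\<delta> * (1 - w k) \<le> prop_entry G i k * (1 - w k)"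
      using w[of k] \<delta>_le[OF k(1)] by (intro mult_right_mono) auto
    also have "\<dots> \<le> (\<Sum>j\<in>pverts G. prop_entry G i j * (1 - w j))"
      using k' pair_finite_verts w prop_entry_nonneg by (intro member_le_sum) auto
    also have "\<dots> \<le> 1 - (\<Sum>j\<in>pverts G. prop_entry G i j * w j)"
      using sum_prop_entry_le_1[OF i] by (simp add: right_diff_distrib sum_subtractf)
    finally have "(\<Sum>j\<in>pverts G. prop_entry G i j * w j) \<le> 1 - 2 * \<epsilon> ^ terminal_dist i"
      using * by (simp add: w_def \<epsilon>(3))
    \<comment> \<open>This is \<open>1 - 2 * x \<le> (1 - x)^2\<close>; afterwards one of the two
      factors \<open>w i\<close> is bounded by the contraction factor.\<close>
    also have "\<dots> \<le> w i * w i"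
      by (simp add: w_def algebra_simps)
    also have "terminal_dist i \<le> R"
      unfolding R_def using i pair_finite_verts by (auto intro!: Max_ge simp: non_terminal_in_verts)
    hence "w i * w i \<le> (1 - \<epsilon> ^ R) * w i"
      using w[of i] \<epsilon> by (intro mult_right_mono) (auto simp: w_def intro!: power_decreasing)
    finally show "(\<Sum>j\<in>pverts G. prop_entry G i j * w j) \<le> (1 - \<epsilon> ^ R) * w i" .
  qed
qed

text \<open>The weight contracts only on non-terminal rows, and \<open>f\<close> vanishes on the
  others, so \<open>f s\<close> is dominated by \<open>w\<close> times a geometric sequence. The
  lemma serves both the differences of the reciprocal iterates and the columns of the powers of
  \<open>A\<close>.\<close>

lemma summable_prop_iterates:
  fixes f :: "nat \<Rightarrow> 'a \<Rightarrow> real"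
  assumes zero: "\<And>s i. terminal G i \<Longrightarrow> f s i = 0"
    and step: "\<And>s i. non_terminal G i \<Longrightarrow> f (Suc s) i = (\<Sum>j\<in>pverts G. prop_entry G i j * f s j)"
    and i: "i \<in> pverts G"
  shows "summable (\<lambda>s. f s i)"
proof -
  obtain \<theta> w where \<theta>: "0 \<le> \<theta>" "\<theta> < 1" and w: "\<And>i. 0 \<le> w i" "\<And>i. non_terminal G i \<Longrightarrow> 1 / 2 \<le> w i"
    and Mw: "\<And>i. non_terminal G i \<Longrightarrow> (\<Sum>j\<in>pverts G. prop_entry G i j * w j) \<le> \<theta> * w i"
    by (rule contraction_weight) blast
  \<comment> \<open>The factor 2 compensates for the bound \<open>1 / 2 \<le> w j\<close> at the
    start of the induction.\<close>
  define C where "C = 2 * (\<Sum>j\<in>pverts G. \<bar>f 0 j\<bar>)"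
  have C: "0 \<le> C" by (auto simp: C_def intro: sum_nonneg)
  have bound: "\<bar>f s j\<bar> \<le> C * \<theta> ^ s * w j" if "j \<in> pverts G" for s j
    using that
  proof (induction s arbitrary: j)
    case 0
    show ?case
    proof (cases "terminal G j")
      case False
      hence "1 / 2 \<le> w j" using 0 w(2) not_terminal_iff by blast
      moreover have "\<bar>f 0 j\<bar> \<le> (\<Sum>j\<in>pverts G. \<bar>f 0 j\<bar>)"
        using 0 pair_finite_verts by (intro member_le_sum) auto
      ultimately show ?thesis
        using mult_mono[of "C / 2" C "1 / 2 * 2" "w j * 2"] mult_left_mono[of "1 / 2" "w j" C] C
        by (simp add: C_def)
    qed (use zero w C in auto)
  next
    case (Suc s)
    show ?case
    proof (cases "terminal G j")
      case False
      hence j: "non_terminal G j" using Suc.prems not_terminal_iff by blast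
      have "\<bar>f (Suc s) j\<bar> \<le> (\<Sum>k\<in>pverts G. \<bar>prop_entry G j k * f s k\<bar>)"
        unfolding step[OF j] by (rule sum_abs)
      also have "\<dots> \<le> (\<Sum>k\<in>pverts G. prop_entry G j k * (C * \<theta> ^ s * w k))"
        using Suc.IH prop_entry_nonneg by (intro sum_mono) (auto simp: abs_mult intro!: mult_left_mono)
      also have "\<dots> = C * \<theta> ^ s * (\<Sum>k\<in>pverts G. prop_entry G j k * w k)"
        by (simp add: sum_distrib_left mult_ac)
      also have "\<dots> \<le> C * \<theta> ^ s * (\<theta> * w j)"
        using Mw[OF j] C \<theta> by (intro mult_left_mono) auto
      finally show ?thesis by (simp add: mult_ac)
    qed (use zero w C \<theta> in auto)
  qed
  show ?thesis
  proof (rule summable_comparison_test')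
    show "summable (\<lambda>s. C * \<theta> ^ s * w i)"
      using \<theta> by (intro summable_mult summable_mult2 summable_geometric) auto
    show "norm (f s i) \<le> C * \<theta> ^ s * w i" if "0 \<le> s" for s
      using bound[OF i] by simp
  qed
qed

end

section \<open>The limiting reciprocal values\<close>

locale valued_terminating_graph = terminating_graph G for G :: "'a pair_pre_digraph" +
  fixes v :: "'a \<Rightarrow> real" and ns ts :: "'a list"
  assumes v_pos: "terminal G j \<Longrightarrow> v j > 0"
    and numbering: "node_numbering G ns ts"
begin

abbreviation u :: "'a \<Rightarrow> real" where
  "u \<equiv> limit_recip G v ns ts"

lemma set_ns: "set ns = {i. non_terminal G i}"
  and set_ts: "set ts = {i. terminal G i}"
  and distinct_ns: "distinct ns"
  and distinct_ts: "distinct ts"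
  using numbering by (auto simp: node_numbering_def)

lemma non_terminal_nth: "k < length ns \<Longrightarrow> non_terminal G (ns ! k)"
  using nth_mem[of k ns] set_ns by auto

lemma terminal_nth: "k < length ts \<Longrightarrow> terminal G (ts ! k)"
  using nth_mem[of k ts] set_ts by auto

lemma distinct_nodes: "distinct (ns @ ts)"
  using distinct_ns distinct_ts set_ns set_ts by (auto simp: terminal_def non_terminal_def)

lemma set_nodes: "set (ns @ ts) = pverts G"
  using set_ns set_ts by (auto simp: terminal_def non_terminal_def)

text \<open>The sequence inside the limit defining \<open>limit_recip\<close>; addressing it by
  nodes allows recursions over the graph.\<close>

definition recip_iter :: "nat \<Rightarrow> 'a \<Rightarrow> real" where
  "recip_iter s i = vec_index ((prop_mat G ns ts ^\<^sub>m s) *\<^sub>v init_vec G v ns ts) (node_index (ns @ ts) i)"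

lemma prop_mat_carrier: "prop_mat G ns ts \<in> carrier_mat (length (ns @ ts)) (length (ns @ ts))"
  by (simp add: prop_mat_def node_mat_def)

lemma init_vec_carrier: "init_vec G v ns ts \<in> carrier_vec (length (ns @ ts))"
  by (simp add: init_vec_def)

lemma recip_iter_nth:
  "k < length (ns @ ts) \<Longrightarrow> recip_iter s ((ns @ ts) ! k)
    = vec_index ((prop_mat G ns ts ^\<^sub>m s) *\<^sub>v init_vec G v ns ts) k"
  unfolding recip_iter_def by (subst node_index_nth[OF distinct_nodes]) auto

lemma recip_iter_0:
  assumes "i \<in> pverts G"
  shows "recip_iter 0 i = (if terminal G i then inverse (v i) else 1)"
proof -
  obtain k where k: "k < length (ns @ ts)" "i = (ns @ ts) ! k"
    using assms set_nodes by (metis in_set_conv_nth)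
  have "1\<^sub>m (length (ns @ ts)) *\<^sub>v init_vec G v ns ts = init_vec G v ns ts"
    by (rule one_mult_mat_vec[OF init_vec_carrier])
  hence "recip_iter 0 i = vec_index (init_vec G v ns ts) k"
    unfolding k(2) recip_iter_nth[OF k(1)] using prop_mat_carrier by simp
  thus ?thesis
    using k by (simp add: init_vec_def del: length_append)
qed

lemma recip_iter_Suc:
  assumes "i \<in> pverts G"
  shows "recip_iter (Suc s) i = (\<Sum>j\<in>pverts G. prop_entry G i j * recip_iter s j)"
proof -
  let ?n = "length (ns @ ts)" and ?M = "prop_mat G ns ts"
  obtain k where k: "k < ?n" "i = (ns @ ts) ! k"
    using assms set_nodes by (metis in_set_conv_nth)
  define y where "y = ?M ^\<^sub>m s *\<^sub>v init_vec G v ns ts"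
  have P: "?M ^\<^sub>m s \<in> carrier_mat ?n ?n"
    using prop_mat_carrier by (rule pow_carrier_mat)
  have y: "y \<in> carrier_vec ?n"
    unfolding y_def using P init_vec_carrier by (rule mult_mat_vec_carrier)
  have "?M ^\<^sub>m Suc s *\<^sub>v init_vec G v ns ts = ?M *\<^sub>v y"
    unfolding y_def pow_mat_Suc_left[OF prop_mat_carrier]
    using prop_mat_carrier P init_vec_carrier by (rule assoc_mult_mat_vec)
  moreover have rec: "recip_iter s ((ns @ ts) ! l) = vec_index y l" if "l < ?n" for l
    using recip_iter_nth[OF that] by (simp add: y_def)
  ultimately have "recip_iter (Suc s) i = vec_index (?M *\<^sub>v y) k"
    unfolding k(2) recip_iter_nth[OF k(1)] by simp
  also have "\<dots> = (\<Sum>l<?n. prop_entry G i ((ns @ ts) ! l) * recip_iter s ((ns @ ts) ! l))"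
    using k(1) y by (simp add: scalar_prod_def lessThan_atLeast0 rec prop_mat_def node_mat_def k(2)
      del: length_append)
  also have "\<dots> = (\<Sum>j\<in>set (ns @ ts). prop_entry G i j * recip_iter s j)"
    by (rule sum_nth_distinct[OF distinct_nodes])
  finally show ?thesis by (simp only: set_nodes)
qed

lemma recip_iter_terminal: "terminal G i \<Longrightarrow> recip_iter s i = inverse (v i)"
  by (induction s) (simp_all add: recip_iter_0 recip_iter_Suc sum_prop_entry_terminal terminal_in_verts)

lemma recip_iter_nonneg: "i \<in> pverts G \<Longrightarrow> 0 \<le> recip_iter s i"
proof (induction s arbitrary: i)
  case 0
  thus ?case using v_pos[of i] by (auto simp: recip_iter_0 less_imp_le)
next
  case (Suc s)
  thus ?case by (auto simp: recip_iter_Suc prop_entry_nonneg intro!: sum_nonneg)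
qed

text \<open>The iterates are constant at terminal nodes, so their successive differences vanish
  there and satisfy the same linear recursion. They are therefore summable, and their telescoping
  partial sums converge.\<close>

lemma recip_iter_tendsto:
  assumes "i \<in> pverts G"
  shows "(\<lambda>s. recip_iter s i) \<longlonglongrightarrow> u i"
proof -
  have "summable (\<lambda>s. recip_iter (Suc s) i - recip_iter s i)"
    using assms
    by (rule summable_prop_iterates[rotated 2])
      (auto simp: recip_iter_terminal recip_iter_Suc non_terminal_in_verts right_diff_distrib sum_subtractf)
  hence "convergent (\<lambda>n. recip_iter n i - recip_iter 0 i)"
    by (simp add: summable_iff_convergent sum_lessThan_telescope[of "\<lambda>s. recip_iter s i"])
  hence "convergent (\<lambda>n. (recip_iter n i - recip_iter 0 i) + recip_iter 0 i)"
    by (intro convergent_add convergent_const)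
  thus ?thesis
    by (simp add: convergent_LIMSEQ_iff limit_recip_def recip_iter_def)
qed

text \<open>Pass to the limit on both sides of the recursion; the sum is finite.\<close>

lemma limit_recip_harmonic:
  assumes "i \<in> pverts G"
  shows "u i = (\<Sum>j\<in>pverts G. prop_entry G i j * u j)"
proof (rule LIMSEQ_unique)
  show "(\<lambda>s. recip_iter (Suc s) i) \<longlonglongrightarrow> u i"
    using recip_iter_tendsto[OF assms] by (rule LIMSEQ_Suc)
  show "(\<lambda>s. recip_iter (Suc s) i) \<longlonglongrightarrow> (\<Sum>j\<in>pverts G. prop_entry G i j * u j)"
    unfolding recip_iter_Suc[OF assms]
    by (intro tendsto_sum tendsto_mult_left recip_iter_tendsto)
qed

lemma limit_recip_nonneg: "i \<in> pverts G \<Longrightarrow> 0 \<le> u i"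
  using LIMSEQ_le_const[OF recip_iter_tendsto] recip_iter_nonneg by blast

lemma limit_recip_terminal: "terminal G i \<Longrightarrow> u i = inverse (v i)"
  using recip_iter_tendsto[OF terminal_in_verts] by (simp add: recip_iter_terminal LIMSEQ_const_iff)

text \<open>Harmonicity writes \<open>u i\<close> as a sum of nonnegative terms, one of which is
  positive.\<close>

lemma limit_recip_arc_pos:
  assumes "(i, j) \<in> parcs G" "0 < u j"
  shows "0 < u i"
proof -
  have i: "non_terminal G i" using arc_non_terminal assms(1) by simp
  have "0 < prop_entry G i j * u j"
    using assms i by (auto simp: prop_entry_non_terminal)
  also have "\<dots> \<le> (\<Sum>j\<in>pverts G. prop_entry G i j * u j)"
    using assms(1) in_arcsD2 prop_entry_nonneg limit_recip_nonneg pair_finite_verts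
    by (intro member_le_sum) auto
  also have "\<dots> = u i"
    using limit_recip_harmonic[OF non_terminal_in_verts[OF i]] by simp
  finally show ?thesis .
qed

text \<open>Positivity holds at terminal nodes and travels backwards along a path leading to
  one.\<close>

lemma limit_recip_pos:
  assumes "i \<in> pverts G"
  shows "0 < u i"
proof -
  have t: "0 < u j" if "terminal G j" for j
    using that v_pos by (simp add: limit_recip_terminal)
  show ?thesis
  proof (cases "terminal G i")
    case False
    then obtain j where j: "terminal G j" "i \<rightarrow>\<^sup>*\<^bsub>G\<^esub> j"
      using reaches_terminal assms not_terminal_iff by blast
    have "(i, j) \<in> (parcs G)\<^sup>*"
      using reachable_rtranclI[OF j(2)] by simp
    thus ?thesis
      by (induction rule: converse_rtrancl_induct) (auto intro: t j limit_recip_arc_pos)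
  qed (rule t)
qed

text \<open>By harmonicity, the sum of \<open>u\<close> over the successors of \<open>i\<close> is
  \<open>u i\<close> times the denominator of the row. For out-degree at least 2 the denominators
  cancel; for out-degree 1 the only successor has \<open>u j = 2 * u i\<close>, which turns the
  entry \<open>1 / 2\<close> into probability 1.\<close>

lemma chooser_prob_eq:
  assumes i: "i \<in> pverts G"
  shows "chooser_prob G v ns ts i j = prop_entry G i j * u j / u i"
proof (cases "terminal G i")
  case True
  thus ?thesis
    using limit_recip_pos[OF i] by (simp add: chooser_prob_def prop_entry_terminal terminal_def)
next
  case False
  hence nt: "non_terminal G i" using i not_terminal_iff by blast
  have deg: "out_degree G i \<noteq> 0" using nt by (simp add: non_terminal_def)
  have ui: "u i = (\<Sum>k | (i, k) \<in> parcs G. u k) / real (max 2 (out_degree G i))"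
    using limit_recip_harmonic[OF i] sum_prop_entry_non_terminal[OF nt] by simp
  show ?thesis
  proof (cases "(i, j) \<in> parcs G")
    case False
    thus ?thesis using nt \<open>\<not> terminal G i\<close> by (simp add: chooser_prob_def prop_entry_non_terminal)
  next
    case True
    have uj: "0 < u j" using True in_arcsD2 by (blast intro: limit_recip_pos)
    show ?thesis
    proof (cases "out_degree G i = 1")
      case True
      then obtain k where "{k. (i, k) \<in> parcs G} = {k}"
        using card_successors[of i] by (auto simp: card_1_singleton_iff)
      hence "{k. (i, k) \<in> parcs G} = {j}"
        using \<open>(i, j) \<in> parcs G\<close> by auto
      thus ?thesis
        using True ui uj nt \<open>(i, j) \<in> parcs G\<close> \<open>\<not> terminal G i\<close>
        by (simp add: chooser_prob_def prop_entry_non_terminal)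
    next
      case False
      hence "max 2 (out_degree G i) = out_degree G i" "out_degree G i \<ge> 2"
        using deg by auto
      thus ?thesis
        using False ui nt \<open>(i, j) \<in> parcs G\<close> \<open>\<not> terminal G i\<close>
        by (simp add: chooser_prob_def prop_entry_non_terminal)
    qed
  qed
qed

end

section \<open>Markov chains and the stopping time\<close>

context markov_chain
begin

lemma X_in_S: "\<omega> \<in> space P \<Longrightarrow> X t \<omega> \<in> S"
  using measurable_space[OF measurable_X] by simp

lemma pred_X [measurable]: "Measurable.pred P (\<lambda>\<omega>. Q (X t \<omega>))"
  by (rule measurable_compose[OF measurable_X]) simp

text \<open>The Markov axiom conditions on one complete history; summing over the finitely many
  histories satisfying \<open>H\<close> extends it to any event of the past. The product form needs
  no positivity of the conditioning event.\<close>

lemma prob_step_history: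
  assumes S: "finite S" and j: "j \<in> S"
  shows "prob {\<omega> \<in> space P. H (\<lambda>s\<in>{..t}. X s \<omega>) \<and> X t \<omega> = i \<and> X (Suc t) \<omega> = j}
    = prob {\<omega> \<in> space P. H (\<lambda>s\<in>{..t}. X s \<omega>) \<and> X t \<omega> = i} * p i j"
proof -
  \<comment> \<open>Extensional functions make the set of histories finite and let distinct
    histories describe disjoint events.\<close>
  define I where "I = {x \<in> {..t} \<rightarrow>\<^sub>E S. H x \<and> x t = i}"
  define F where "F x = {\<omega> \<in> space P. \<forall>s\<le>t. X s \<omega> = x s}" for x
  define F' where "F' x = {\<omega> \<in> space P. X (Suc t) \<omega> = j \<and> (\<forall>s\<le>t. X s \<omega> = x s)}" for x
  have I: "finite I"
    unfolding I_def using S by (intro finite_subset[OF _ finite_PiE[of "{..t}" "\<lambda>_. S"]]) auto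
  have F: "F x \<in> events" "F' x \<in> events" for x
    unfolding F_def F'_def by measurable
  have restrict_eq: "(\<lambda>s\<in>{..t}. X s \<omega>) = x" if "x \<in> I" "\<forall>s\<le>t. X s \<omega> = x s" for x \<omega>
    using that by (intro ext) (auto simp: I_def PiE_def extensional_def)
  have disj: "disjoint_family_on F I"
    unfolding disjoint_family_on_def
  proof (intro ballI impI equals0I)
    fix x y \<omega> assume "x \<in> I" "y \<in> I" "x \<noteq> y" "\<omega> \<in> F x \<inter> F y"
    hence "(\<lambda>s\<in>{..t}. X s \<omega>) = x" "(\<lambda>s\<in>{..t}. X s \<omega>) = y"
      by (auto simp: F_def intro!: restrict_eq)
    thus False using \<open>x \<noteq> y\<close> by simp
  qed
  have F'_eq: "F' x = F x \<inter> {\<omega>. X (Suc t) \<omega> = j}" for x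
    by (auto simp: F_def F'_def)
  have disj': "disjoint_family_on F' I"
    using disj unfolding disjoint_family_on_def F'_eq by blast
  have restrict_in: "(\<lambda>s\<in>{..t}. X s \<omega>) \<in> I"
    if "\<omega> \<in> space P" "H (\<lambda>s\<in>{..t}. X s \<omega>)" "X t \<omega> = i" for \<omega>
    using that X_in_S by (auto simp: I_def)
  have Un: "{\<omega> \<in> space P. H (\<lambda>s\<in>{..t}. X s \<omega>) \<and> X t \<omega> = i} = (\<Union>x\<in>I. F x)" (is "?L = ?R")
  proof (intro subset_antisym subsetI)
    fix \<omega> assume "\<omega> \<in> ?L"
    thus "\<omega> \<in> ?R" using restrict_in by (intro UN_I[of "\<lambda>s\<in>{..t}. X s \<omega>"]) (auto simp: F_def)
  next
    fix \<omega> assume "\<omega> \<in> ?R"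
    then obtain x where x: "x \<in> I" "\<omega> \<in> F x" by blast
    thus "\<omega> \<in> ?L" using restrict_eq[OF x(1), of \<omega>] by (auto simp: F_def I_def)
  qed
  have Un': "{\<omega> \<in> space P. H (\<lambda>s\<in>{..t}. X s \<omega>) \<and> X t \<omega> = i \<and> X (Suc t) \<omega> = j} = (\<Union>x\<in>I. F' x)"
    unfolding F'_eq using Un by blast
  have step: "prob (F' x) = prob (F x) * p i j" if "x \<in> I" for x
  proof (cases "prob (F x) > 0")
    case True
    thus ?thesis
      using markov[of t x j] j that unfolding cond_prob_def
      by (simp add: F_def F'_def I_def field_simps)
  next
    \<comment> \<open>The axiom says nothing about histories of probability zero, but then both
      sides vanish.\<close>
    case False
    hence "prob (F x) = 0" using measure_nonneg[of P "F x"] by simp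
    moreover have "prob (F' x) \<le> prob (F x)"
      using F by (intro finite_measure_mono) (auto simp: F_def F'_def)
    ultimately show ?thesis using measure_nonneg[of P "F' x"] by simp
  qed
  show ?thesis
    unfolding Un Un'
    using finite_measure_finite_Union[OF I _ disj] finite_measure_finite_Union[OF I _ disj'] F
    by (simp add: step sum_distrib_right image_subset_iff)
qed

end

section \<open>The stopping time in terms of the path\<close>

lemma stop_time_greater_iff:
  "enat t < stop_time G X \<omega> \<longleftrightarrow> (\<forall>s\<le>t. \<not> terminal G (X s \<omega>))"
  unfolding stop_time_def Suc_ile_eq[symmetric] le_INF_iff by (auto simp: not_less_eq_eq[symmetric])

lemma stop_time_eq_iff:
  "stop_time G X \<omega> = enat t \<longleftrightarrow> terminal G (X t \<omega>) \<and> (\<forall>s<t. \<not> terminal G (X s \<omega>))"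
proof -
  have "enat t \<le> stop_time G X \<omega> \<longleftrightarrow> (\<forall>s<t. \<not> terminal G (X s \<omega>))"
    unfolding stop_time_def le_INF_iff by (auto simp: not_less[symmetric])
  moreover have "stop_time G X \<omega> = enat t \<longleftrightarrow>
      enat t \<le> stop_time G X \<omega> \<and> \<not> enat t < stop_time G X \<omega>"
    by auto
  ultimately show ?thesis
    by (auto simp: stop_time_greater_iff le_less)
qed

lemma stop_time_infinity_iff:
  "stop_time G X \<omega> = \<infinity> \<longleftrightarrow> (\<forall>t. \<not> terminal G (X t \<omega>))"
proof
  assume "stop_time G X \<omega> = \<infinity>"
  hence "enat t < stop_time G X \<omega>" for t by simp
  thus "\<forall>t. \<not> terminal G (X t \<omega>)" unfolding stop_time_greater_iff by blast
qed (auto simp: stop_time_def top_enat_def)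

text \<open>\<open>enat\<close> is countable, so it suffices to check the preimage of each single
  value, including the infinite one.\<close>

lemma (in markov_chain) measurable_stop_time [measurable]:
  "stop_time G X \<in> measurable P (count_space UNIV)"
proof (subst measurable_count_space_eq_countable, safe)
  fix a :: enat
  have "Measurable.pred P (\<lambda>\<omega>. stop_time G X \<omega> = a)"
    by (cases a) (simp_all add: stop_time_eq_iff stop_time_infinity_iff)
  thus "stop_time G X -` {a} \<inter> space P \<in> events"
    by (simp add: pred_def vimage_def Int_def conj_commute)
qed auto

section \<open>Stopping time and terminal node of the Chooser's chain\<close>

context valued_terminating_graph
begin

abbreviation A :: "real mat" where "A \<equiv> block_A G ns"
abbreviation B :: "real mat" where "B \<equiv> block_B G ns ts"

lemma A_carrier: "A \<in> carrier_mat (length ns) (length ns)"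
  by (simp add: block_A_def node_mat_def)

lemma B_carrier: "B \<in> carrier_mat (length ns) (length ts)"
  by (simp add: block_B_def node_mat_def)

lemma A_pow_carrier: "A ^\<^sub>m t \<in> carrier_mat (length ns) (length ns)"
  using A_carrier by (rule pow_carrier_mat)

lemma A_index: "a < length ns \<Longrightarrow> b < length ns \<Longrightarrow> A $$ (a, b) = prop_entry G (ns ! a) (ns ! b)"
  by (simp add: block_A_def node_mat_def)

lemma B_index: "a < length ns \<Longrightarrow> c < length ts \<Longrightarrow> B $$ (a, c) = prop_entry G (ns ! a) (ts ! c)"
  by (simp add: block_B_def node_mat_def)

text \<open>Column \<open>b\<close> of the powers, extended by zero to the terminal nodes, obeys the
  recursion of \<open>summable_prop_iterates\<close>.\<close>

lemma summable_A_pow: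
  assumes a: "a < length ns" and b: "b < length ns"
  shows "summable (\<lambda>t. (A ^\<^sub>m t) $$ (a, b))"
proof -
  define f where "f t i = (if non_terminal G i then (A ^\<^sub>m t) $$ (node_index ns i, b) else 0)" for t i
  have f_nth: "f t (ns ! k) = (A ^\<^sub>m t) $$ (k, b)" if "k < length ns" for t k
    using that by (simp add: f_def non_terminal_nth node_index_nth[OF distinct_ns])
  have "summable (\<lambda>t. f t (ns ! a))"
  proof (rule summable_prop_iterates)
    fix t i assume "non_terminal G i"
    then obtain k where k: "k < length ns" "i = ns ! k"
      using set_ns by (metis in_set_conv_nth mem_Collect_eq)
    have "f (Suc t) i = (\<Sum>l<length ns. prop_entry G i (ns ! l) * f t (ns ! l))"
      unfolding k(2) f_nth[OF k(1)] pow_mat_Suc_left[OF A_carrier]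
      using k(1) b A_carrier A_pow_carrier[of t]
      by (simp add: scalar_prod_def lessThan_atLeast0 f_nth A_index)
    also have "\<dots> = (\<Sum>j\<in>set ns. prop_entry G i j * f t j)"
      by (rule sum_nth_distinct[OF distinct_ns])
    also have "\<dots> = (\<Sum>j\<in>pverts G. prop_entry G i j * f t j)"
      using pair_finite_verts set_ns by (intro sum.mono_neutral_left) (auto simp: f_def non_terminal_in_verts)
    finally show "f (Suc t) i = (\<Sum>j\<in>pverts G. prop_entry G i j * f t j)" .
  qed (use a non_terminal_nth non_terminal_in_verts in \<open>auto simp: f_def terminal_def non_terminal_def\<close>)
  thus ?thesis by (simp add: f_nth[OF a])
qed

lemma resolvent_eq:
  "mat_inv (1\<^sub>m (length ns) - A)
    = mat (length ns) (length ns) (\<lambda>(a, b). \<Sum>t. (A ^\<^sub>m t) $$ (a, b))"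
  using A_carrier summable_A_pow by (rule mat_inv_neumann)

lemma resolvent_carrier: "mat_inv (1\<^sub>m (length ns) - A) \<in> carrier_mat (length ns) (length ns)"
  by (simp add: resolvent_eq)

lemma A_pow_sums_resolvent:
  assumes "a < length ns" "b < length ns"
  shows "(\<lambda>t. (A ^\<^sub>m t) $$ (a, b)) sums (mat_inv (1\<^sub>m (length ns) - A) $$ (a, b))"
  using summable_sums[OF summable_A_pow[OF assms]] assms by (simp add: resolvent_eq)

lemma A_pow_B_sums_resolvent:
  assumes a: "a < length ns" and c: "c < length ts"
  shows "(\<lambda>t. (A ^\<^sub>m t * B) $$ (a, c)) sums ((mat_inv (1\<^sub>m (length ns) - A) * B) $$ (a, c))"
proof -
  have "(\<lambda>t. \<Sum>b<length ns. (A ^\<^sub>m t) $$ (a, b) * B $$ (b, c))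
      sums (\<Sum>b<length ns. mat_inv (1\<^sub>m (length ns) - A) $$ (a, b) * B $$ (b, c))"
    using a by (intro sums_sum sums_mult2 A_pow_sums_resolvent) auto
  thus ?thesis
    by (simp add: mult_mat_index[OF A_pow_carrier B_carrier a c]
        mult_mat_index[OF resolvent_carrier B_carrier a c])
qed

section \<open>Conjugation by the diagonal value matrices\<close>

lemma limit_recip_ns_nonzero: "a < length ns \<Longrightarrow> u (ns ! a) \<noteq> 0"
  using limit_recip_pos non_terminal_nth non_terminal_in_verts by (metis less_irrefl)

lemma limit_recip_ts_nonzero: "c < length ts \<Longrightarrow> u (ts ! c) \<noteq> 0"
  using limit_recip_pos terminal_nth terminal_in_verts by (metis less_irrefl)

lemma mat_inv_V_nt: "mat_inv (V_nt G v ns ts) = mat_diag (length ns) (\<lambda>a. u (ns ! a))"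
  unfolding V_nt_def limit_value_def
  by (subst mat_inv_mat_diag) (simp_all add: limit_recip_ns_nonzero)

lemma mat_inv_V_t: "mat_inv (V_t G v ns ts) = mat_diag (length ts) (\<lambda>c. u (ts ! c))"
  unfolding V_t_def limit_value_def
  by (subst mat_inv_mat_diag) (simp_all add: limit_recip_ts_nonzero)

lemma V_nt_carrier:
  "V_nt G v ns ts \<in> carrier_mat (length ns) (length ns)"
  "mat_inv (V_nt G v ns ts) \<in> carrier_mat (length ns) (length ns)"
  by (simp_all add: mat_inv_V_nt, simp add: V_nt_def)

lemma V_t_carrier: "mat_inv (V_t G v ns ts) \<in> carrier_mat (length ts) (length ts)"
  by (simp add: mat_inv_V_t)

text \<open>The values are reciprocals of \<open>u\<close>, so conjugation produces the quotient of
  the \<open>u\<close> at the end and at the start, the same factor that the transition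
  probabilities collect along a path.\<close>

lemma V_nt_sandwich_V_nt:
  assumes "M \<in> carrier_mat (length ns) (length ns)" "a < length ns" "b < length ns"
  shows "(V_nt G v ns ts * M * mat_inv (V_nt G v ns ts)) $$ (a, b) = M $$ (a, b) * u (ns ! b) / u (ns ! a)"
  unfolding mat_inv_V_nt unfolding V_nt_def limit_value_def
  by (subst mat_diag_mult_sandwich[OF assms]) (simp add: field_simps)

lemma V_nt_sandwich_V_t:
  assumes "M \<in> carrier_mat (length ns) (length ts)" "a < length ns" "c < length ts"
  shows "(V_nt G v ns ts * M * mat_inv (V_t G v ns ts)) $$ (a, c) = M $$ (a, c) * u (ts ! c) / u (ns ! a)"
  unfolding mat_inv_V_t unfolding V_nt_def limit_value_def
  by (subst mat_diag_mult_sandwich[OF assms]) (simp add: field_simps)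

end

section \<open>Arrival probabilities of the Chooser's chain\<close>

locale chooser_chain = valued_terminating_graph G v ns ts
  + markov_chain P "pverts G" "chooser_prob G v ns ts" X
  for G :: "'a pair_pre_digraph" and v :: "'a \<Rightarrow> real" and ns ts :: "'a list"
    and P :: "'w measure" and X :: "nat \<Rightarrow> 'w \<Rightarrow> 'a"
begin

text \<open>For terminal \<open>k\<close> this is stopping at time \<open>t\<close> in
  \<open>k\<close>; for non-terminal \<open>k\<close> it is being at \<open>k\<close> with the game
  still running. The start is part of the event, so division by its probability is postponed to the
  end.\<close>

definition arrival_event :: "nat \<Rightarrow> 'a \<Rightarrow> 'a \<Rightarrow> 'w set" where
  "arrival_event t i k =
    {\<omega> \<in> space P. X 0 \<omega> = i \<and> (\<forall>s<t. non_terminal G (X s \<omega>)) \<and> X t \<omega> = k}"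

lemma arrival_event_sets [measurable]: "arrival_event t i k \<in> events"
  unfolding arrival_event_def by measurable

lemma disjoint_arrival_events: "disjoint_family_on (arrival_event t i) K"
  by (auto simp: disjoint_family_on_def arrival_event_def)

lemma prob_arrival_0:
  "prob (arrival_event 0 i k) = (if k = i then prob {\<omega> \<in> space P. X 0 \<omega> = i} else 0)"
proof -
  have "arrival_event 0 i k = (if k = i then {\<omega> \<in> space P. X 0 \<omega> = i} else {})"
    by (auto simp: arrival_event_def)
  thus ?thesis by simp
qed

text \<open>Split by the position at time \<open>t\<close>, which has to be non-terminal, and apply
  the Markov property to the past.\<close>

lemma prob_arrival_Suc:
  assumes k: "k \<in> pverts G"
  shows "prob (arrival_event (Suc t) i k)
    = (\<Sum>l\<in>set ns. prob (arrival_event t i l) * chooser_prob G v ns ts l k)"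
proof -
  define E where
    "E l = {\<omega> \<in> space P. (X 0 \<omega> = i \<and> (\<forall>s<t. non_terminal G (X s \<omega>))) \<and> X t \<omega> = l \<and> X (Suc t) \<omega> = k}" for l
  have E: "prob (E l) = prob (arrival_event t i l) * chooser_prob G v ns ts l k" for l
    using prob_step_history[OF pair_finite_verts k,
        of "\<lambda>x. x 0 = i \<and> (\<forall>s<t. non_terminal G (x s))" t l]
    by (simp add: E_def arrival_event_def conj_assoc)
  have "arrival_event (Suc t) i k = (\<Union>l\<in>set ns. E l)"
    using set_ns by (auto simp: arrival_event_def E_def less_Suc_eq)
  moreover have "E l \<in> events" for l
    unfolding E_def by measurable
  moreover have "disjoint_family_on E (set ns)"
    by (auto simp: disjoint_family_on_def E_def)
  ultimately show ?thesis
    by (simp add: finite_measure_finite_Union image_subset_iff E)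
qed

lemma prob_arrival_non_terminal:
  assumes r: "r < length ns" and b: "b < length ns"
  shows "prob (arrival_event t (ns ! r) (ns ! b))
    = prob {\<omega> \<in> space P. X 0 \<omega> = ns ! r} * ((A ^\<^sub>m t) $$ (r, b) * u (ns ! b) / u (ns ! r))"
  using b
proof (induction t arbitrary: b)
  case 0
  show ?case
    using 0 r limit_recip_ns_nonzero[OF r] A_carrier distinct_ns by (auto simp: prob_arrival_0 nth_eq_iff_index_eq)
next
  case (Suc t)
  have "prob (arrival_event (Suc t) (ns ! r) (ns ! b)) =
      (\<Sum>l<length ns. prob (arrival_event t (ns ! r) (ns ! l)) * chooser_prob G v ns ts (ns ! l) (ns ! b))"
    using Suc.prems
    by (simp add: prob_arrival_Suc non_terminal_in_verts[OF non_terminal_nth] sum_nth_distinct[OF distinct_ns, symmetric])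
  \<comment> \<open>The factor \<open>u (ns ! l)\<close> gained up to time \<open>t\<close> cancels
    against the denominator of the next transition.\<close>
  also have "\<dots> = (\<Sum>l<length ns. prob {\<omega> \<in> space P. X 0 \<omega> = ns ! r} *
      (((A ^\<^sub>m t) $$ (r, l) * A $$ (l, b)) * u (ns ! b) / u (ns ! r)))"
    using Suc limit_recip_ns_nonzero
    by (intro sum.cong) (auto simp: chooser_prob_eq non_terminal_in_verts[OF non_terminal_nth] A_index)
  also have "\<dots> = prob {\<omega> \<in> space P. X 0 \<omega> = ns ! r} *
      ((A ^\<^sub>m Suc t) $$ (r, b) * u (ns ! b) / u (ns ! r))"
    by (simp add: mult_mat_index[OF A_pow_carrier A_carrier r Suc.prems]
        sum_distrib_left sum_distrib_right sum_divide_distrib)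
  finally show ?case .
qed

text \<open>The same cancellation, with the last transition taken from \<open>B\<close>: absorption
  at time \<open>Suc t\<close> follows \<open>t\<close> moves among non-terminal nodes.\<close>

lemma prob_arrival_terminal:
  assumes r: "r < length ns" and c: "c < length ts"
  shows "prob (arrival_event (Suc t) (ns ! r) (ts ! c))
    = prob {\<omega> \<in> space P. X 0 \<omega> = ns ! r} * ((A ^\<^sub>m t * B) $$ (r, c) * u (ts ! c) / u (ns ! r))"
proof -
  have "prob (arrival_event (Suc t) (ns ! r) (ts ! c)) =
      (\<Sum>l<length ns. prob (arrival_event t (ns ! r) (ns ! l)) * chooser_prob G v ns ts (ns ! l) (ts ! c))"
    using c
    by (simp add: prob_arrival_Suc terminal_in_verts[OF terminal_nth] sum_nth_distinct[OF distinct_ns, symmetric])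
  also have "\<dots> = (\<Sum>l<length ns. prob {\<omega> \<in> space P. X 0 \<omega> = ns ! r} *
      (((A ^\<^sub>m t) $$ (r, l) * B $$ (l, c)) * u (ts ! c) / u (ns ! r)))"
    using r c limit_recip_ns_nonzero
    by (intro sum.cong) (auto simp: prob_arrival_non_terminal chooser_prob_eq
        non_terminal_in_verts[OF non_terminal_nth] B_index)
  also have "\<dots> = prob {\<omega> \<in> space P. X 0 \<omega> = ns ! r} *
      ((A ^\<^sub>m t * B) $$ (r, c) * u (ts ! c) / u (ns ! r))"
    by (simp add: mult_mat_index[OF A_pow_carrier B_carrier r c]
        sum_distrib_left sum_distrib_right sum_divide_distrib)
  finally show ?thesis .
qed

lemma non_terminal_X_iff: "\<omega> \<in> space P \<Longrightarrow> non_terminal G (X t \<omega>) \<longleftrightarrow> \<not> terminal G (X t \<omega>)"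
  using X_in_S not_terminal_iff by blast

text \<open>The game runs beyond time \<open>t\<close> iff all positions up to \<open>t\<close> are
  non-terminal; the last of them sorts the event into disjoint pieces.\<close>

lemma prob_stop_time_greater:
  "prob {\<omega> \<in> space P. X 0 \<omega> = i \<and> enat t < stop_time G X \<omega>} = (\<Sum>k\<in>set ns. prob (arrival_event t i k))"
proof -
  have "{\<omega> \<in> space P. X 0 \<omega> = i \<and> enat t < stop_time G X \<omega>} = (\<Union>k\<in>set ns. arrival_event t i k)"
    using set_ns by (auto simp: arrival_event_def stop_time_greater_iff non_terminal_X_iff le_less)
  thus ?thesis
    using disjoint_arrival_events by (simp add: finite_measure_finite_Union image_subset_iff)
qed

lemma arrival_event_terminal_eq:
  assumes "terminal G k"
  shows "{\<omega> \<in> space P. X 0 \<omega> = i \<and> stop_time G X \<omega> = enat t \<and> X t \<omega> = k} = arrival_event t i k"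
  using assms by (auto simp: arrival_event_def stop_time_eq_iff non_terminal_X_iff)

lemma prob_stop_time_eq:
  "prob {\<omega> \<in> space P. X 0 \<omega> = i \<and> stop_time G X \<omega> = enat t} = (\<Sum>k\<in>set ts. prob (arrival_event t i k))"
proof -
  have "{\<omega> \<in> space P. X 0 \<omega> = i \<and> stop_time G X \<omega> = enat t} = (\<Union>k\<in>set ts. arrival_event t i k)"
    using set_ts by (auto simp: arrival_event_def stop_time_eq_iff non_terminal_X_iff)
  thus ?thesis
    using disjoint_arrival_events by (simp add: finite_measure_finite_Union image_subset_iff)
qed

text \<open>Countable additivity over the arrival time; paths that never stop lie outside the
  event.\<close>

lemma prob_arrival_sums:
  assumes "terminal G k"
  shows "(\<lambda>t. prob (arrival_event t i k)) sums
    prob {\<omega> \<in> space P. X 0 \<omega> = i \<and> (\<exists>t. stop_time G X \<omega> = enat t \<and> X t \<omega> = k)}"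
proof -
  have "{\<omega> \<in> space P. X 0 \<omega> = i \<and> (\<exists>t. stop_time G X \<omega> = enat t \<and> X t \<omega> = k)} = (\<Union>t. arrival_event t i k)"
    unfolding arrival_event_terminal_eq[OF assms, symmetric] by auto
  moreover have "disjoint_family (\<lambda>t. arrival_event t i k)"
    unfolding arrival_event_terminal_eq[OF assms, symmetric] by (auto simp: disjoint_family_on_def)
  ultimately show ?thesis
    using finite_measure_UNION[of "\<lambda>t. arrival_event t i k"] by (simp add: image_subset_iff)
qed

section \<open>Conditioning on a non-terminal start of positive probability\<close>

context
  fixes r :: nat
  assumes r: "r < length ns" and start_pos: "prob {\<omega> \<in> space P. X 0 \<omega> = ns ! r} > 0"
begin

text \<open>The expectation is the sum of the tail probabilities \<open>?q t\<close>, and the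
  Neumann series evaluates it. As the integral is extended nonnegative, finiteness is a
  result.\<close>

lemma expected_stop_time:
  "cond_expect P (\<lambda>\<omega>. ennreal_of_enat (stop_time G X \<omega>)) (\<lambda>\<omega>. X 0 \<omega> = ns ! r)
    = ennreal ((V_nt G v ns ts * mat_inv (1\<^sub>m (length ns) - A) * mat_inv (V_nt G v ns ts)
        *\<^sub>v ones (length ns)) $ r)" (is "_ = ennreal ?E")
proof -
  let ?C = "{\<omega> \<in> space P. X 0 \<omega> = ns ! r}"
  let ?q = "\<lambda>t. \<Sum>b<length ns. (A ^\<^sub>m t) $$ (r, b) * u (ns ! b) / u (ns ! r)"
  have C: "?C \<in> events" by measurable
  have tail: "prob {\<omega> \<in> space P. X 0 \<omega> = ns ! r \<and> enat t < stop_time G X \<omega>} = prob ?C * ?q t" for t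
    unfolding prob_stop_time_greater sum_nth_distinct[OF distinct_ns, symmetric]
    by (simp add: prob_arrival_non_terminal[OF r] sum_distrib_left)
  \<comment> \<open>Nonnegativity, needed to move the real series to \<open>ennreal\<close>, is read
    off from the probabilistic meaning of \<open>?q t\<close>.\<close>
  have q_nonneg: "0 \<le> ?q t" for t
    using tail[of t] start_pos measure_nonneg[of P "{\<omega> \<in> space P. X 0 \<omega> = ns ! r \<and> enat t < stop_time G X \<omega>}"]
    by (simp add: zero_le_mult_iff)
  have q: "emeasure (uniform_measure P ?C) {\<omega> \<in> space P. enat t < stop_time G X \<omega>} = ennreal (?q t)" for t
  proof -
    have "?C \<inter> {\<omega> \<in> space P. enat t < stop_time G X \<omega>}
        = {\<omega> \<in> space P. X 0 \<omega> = ns ! r \<and> enat t < stop_time G X \<omega>}" by auto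
    thus ?thesis
      using start_pos by (simp add: emeasure_uniform_measure C emeasure_eq_measure tail divide_ennreal q_nonneg)
  qed
  have "?E = (\<Sum>b<length ns. (V_nt G v ns ts * mat_inv (1\<^sub>m (length ns) - A)
      * mat_inv (V_nt G v ns ts)) $$ (r, b))"
    using r resolvent_carrier V_nt_carrier by (intro mult_ones_index[where n = "length ns"]) auto
  also have "\<dots> = (\<Sum>b<length ns. mat_inv (1\<^sub>m (length ns) - A) $$ (r, b) * u (ns ! b) / u (ns ! r))"
    by (intro sum.cong V_nt_sandwich_V_nt resolvent_carrier r) auto
  also have "?q sums \<dots>"
    using r by (intro sums_sum sums_divide sums_mult2 A_pow_sums_resolvent) auto
  finally have "?q sums ?E" .
  hence "(\<Sum>t. ennreal (?q t)) = ennreal ?E"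
    using q_nonneg by (intro suminf_ennreal_eq) auto
  moreover have "stop_time G X \<in> measurable (uniform_measure P ?C) (count_space UNIV)"
    unfolding measurable_cong_sets[OF sets_uniform_measure refl] by (rule measurable_stop_time)
  ultimately show ?thesis
    unfolding cond_expect_def by (subst nn_integral_enat_function) (simp_all add: q)
qed

text \<open>Stopping at time \<open>t\<close> uses \<open>t - 1\<close> moves through
  \<open>A\<close> and one through \<open>B\<close>; the product with the vector of ones sums over
  the terminal nodes.\<close>

lemma prob_stop_time:
  assumes "t \<ge> 1"
  shows "\<P>(\<omega> in P. stop_time G X \<omega> = enat t \<bar> X 0 \<omega> = ns ! r)
    = (V_nt G v ns ts * A ^\<^sub>m (t - 1) * B * mat_inv (V_t G v ns ts) *\<^sub>v ones (length ts)) $ r"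
proof -
  have AB: "A ^\<^sub>m (t - 1) * B \<in> carrier_mat (length ns) (length ts)"
    using A_pow_carrier B_carrier by (rule mult_carrier_mat)
  have "prob {\<omega> \<in> space P. X 0 \<omega> = ns ! r \<and> stop_time G X \<omega> = enat t}
    = prob {\<omega> \<in> space P. X 0 \<omega> = ns ! r}
      * (\<Sum>c<length ts. (A ^\<^sub>m (t - 1) * B) $$ (r, c) * u (ts ! c) / u (ns ! r))"
    unfolding prob_stop_time_eq sum_nth_distinct[OF distinct_ts, symmetric]
    using prob_arrival_terminal[OF r, of _ "t - 1"] assms by (simp add: sum_distrib_left)
  moreover have "(V_nt G v ns ts * A ^\<^sub>m (t - 1) * B * mat_inv (V_t G v ns ts) *\<^sub>v ones (length ts)) $ r
    = (\<Sum>c<length ts. (A ^\<^sub>m (t - 1) * B) $$ (r, c) * u (ts ! c) / u (ns ! r))"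
  proof -
    have "(V_nt G v ns ts * A ^\<^sub>m (t - 1) * B * mat_inv (V_t G v ns ts) *\<^sub>v ones (length ts)) $ r
      = (\<Sum>c<length ts. (V_nt G v ns ts * (A ^\<^sub>m (t - 1) * B) * mat_inv (V_t G v ns ts)) $$ (r, c))"
      unfolding assoc_mult_mat[OF V_nt_carrier(1) A_pow_carrier B_carrier]
      using r AB V_nt_carrier(1) V_t_carrier by (intro mult_ones_index[where n = "length ns"]) auto
    also have "\<dots> = (\<Sum>c<length ts. (A ^\<^sub>m (t - 1) * B) $$ (r, c) * u (ts ! c) / u (ns ! r))"
      by (intro sum.cong V_nt_sandwich_V_t AB r) auto
    finally show ?thesis .
  qed
  ultimately show ?thesis
    using start_pos by (simp add: cond_prob_def conj_commute)
qed

text \<open>Summing the arrival probabilities over all times turns the powers of \<open>A\<close>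
  into the resolvent.\<close>

lemma prob_terminal_node:
  assumes c: "c < length ts"
  shows "\<P>(\<omega> in P. (\<exists>t. stop_time G X \<omega> = enat t \<and> X t \<omega> = ts ! c) \<bar> X 0 \<omega> = ns ! r)
    = (V_nt G v ns ts * mat_inv (1\<^sub>m (length ns) - A) * B * mat_inv (V_t G v ns ts)) $$ (r, c)"
proof -
  let ?R = "mat_inv (1\<^sub>m (length ns) - A)" and ?\<pi> = "prob {\<omega> \<in> space P. X 0 \<omega> = ns ! r}"
  have RB: "?R * B \<in> carrier_mat (length ns) (length ts)"
    using resolvent_carrier B_carrier by (rule mult_carrier_mat)
  \<comment> \<open>The start is non-terminal, so the term for time 0 vanishes and the series may be
    shifted to begin at time 1.\<close>
  have "prob (arrival_event 0 (ns ! r) (ts ! c)) = 0"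
    using terminal_nth[OF c] non_terminal_nth[OF r]
    by (auto simp: prob_arrival_0 terminal_def non_terminal_def)
  hence "(\<lambda>t. prob (arrival_event (Suc t) (ns ! r) (ts ! c))) sums
      prob {\<omega> \<in> space P. X 0 \<omega> = ns ! r \<and> (\<exists>t. stop_time G X \<omega> = enat t \<and> X t \<omega> = ts ! c)}"
    using prob_arrival_sums[OF terminal_nth[OF c], of "ns ! r"]
    unfolding sums_Suc_iff[of "\<lambda>t. prob (arrival_event t (ns ! r) (ts ! c))"] by simp
  moreover have "(\<lambda>t. prob (arrival_event (Suc t) (ns ! r) (ts ! c))) sums
      (?\<pi> * ((?R * B) $$ (r, c) * u (ts ! c) / u (ns ! r)))"
    unfolding prob_arrival_terminal[OF r c]
    by (intro sums_mult sums_divide sums_mult2 A_pow_B_sums_resolvent r c)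
  ultimately have "prob {\<omega> \<in> space P. X 0 \<omega> = ns ! r \<and> (\<exists>t. stop_time G X \<omega> = enat t \<and> X t \<omega> = ts ! c)}
      = ?\<pi> * ((?R * B) $$ (r, c) * u (ts ! c) / u (ns ! r))"
    by (rule sums_unique2)
  thus ?thesis
    unfolding assoc_mult_mat[OF V_nt_carrier(1) resolvent_carrier B_carrier] V_nt_sandwich_V_t[OF RB r c]
    using start_pos by (simp add: cond_prob_def conj_commute)
qed

end

end

theorem theorem4:
  fixes G :: "'a pair_pre_digraph" and v :: "'a \<Rightarrow> real" and ns ts :: "'a list"
    and P :: "'w measure" and X :: "nat \<Rightarrow> 'w \<Rightarrow> 'a" and r :: nat
  assumes "terminating_graph G"
    and "\<And>j. terminal G j \<Longrightarrow> v j > 0"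
    and "node_numbering G ns ts"
    and "markov_chain P (pverts G) (chooser_prob G v ns ts) X"
    and "r < length ns"
    and "\<P>(\<omega> in P. X 0 \<omega> = ns ! r) > 0"
  defines "A \<equiv> block_A G ns" and "B \<equiv> block_B G ns ts"
    and "Vnt \<equiv> V_nt G v ns ts" and "Vt \<equiv> V_t G v ns ts"
  defines "R \<equiv> mat_inv (1\<^sub>m (length ns) - A)"
    and "T \<equiv> stop_time G X"
  shows "cond_expect P (\<lambda>\<omega>. ennreal_of_enat (T \<omega>)) (\<lambda>\<omega>. X 0 \<omega> = ns ! r)
           = ennreal ((Vnt * R * mat_inv Vnt *\<^sub>v ones (length ns)) $ r)
    \<and> (\<forall>t\<ge>1. \<P>(\<omega> in P. T \<omega> = enat t \<bar> X 0 \<omega> = ns ! r)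
           = (Vnt * A ^\<^sub>m (t - 1) * B * mat_inv Vt *\<^sub>v ones (length ts)) $ r)
    \<and> (\<forall>c<length ts.
         \<P>(\<omega> in P. (\<exists>t. T \<omega> = enat t \<and> X t \<omega> = ts ! c) \<bar> X 0 \<omega> = ns ! r)
           = (Vnt * R * B * mat_inv Vt) $$ (r, c))"
proof -
  interpret terminating_graph G by (rule assms(1))
  interpret valued_terminating_graph G v ns ts
    by unfold_locales (rule assms(2,3); assumption)+
  interpret markov_chain P "pverts G" "chooser_prob G v ns ts" X by (rule assms(4))
  interpret chooser_chain G v ns ts P X ..
  show ?thesis
    unfolding A_def B_def Vnt_def Vt_def R_def T_def
    using expected_stop_time[OF assms(5,6)] prob_stop_time[OF assms(5,6)]
      prob_terminal_node[OF assms(5,6)] by blast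
qed

end
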